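(* Let $L$ be a Heyting algebra with finite connected decompositions. (a) Let $F\subseteq L$ be finite. If each element of $F$ is a finite join of primals, and $D$ is the result of the transversal construction (applied to $F$), then $(F,D)$ is a finite duality. (b) Conversely, if $(F,D)$ is a finite duality, then each element of $F$ decomposes into a finite join of primals and $D$ is the result of the transversal construction (applied to $F$).
   Context: A Heyting algebra is a lattice $(L,\preceq,\vee,\wedge)$ with a least element and a greatest element and with an additional binary operation $\Rightarrow$ such that for all $p,q,r\in L$: $p\preceq (q\Rightarrow r)$ if and only if $p\wedge q\preceq r$. An element $a\in L$ is connected if $a=b\vee c$ implies $a=b$ or $a=c$. $L$ has finite connected decompositions if each element of $L$ is the supremum of a finite set of connected elements. A pair $(f,d)$ of elements of $L$ is a duality pair if for every $x\in L$: $f\preceq x$ if and only if $x\not\preceq d$. An element $f\in L$ is a primal if there is $d\in L$ such that $(f,d)$ is a duality pair. A finite duality is a pair $(F,D)$ of finite subsets of $L$ such that $f\not\preceq f'$ for distinct $f,f'\in F$, $d\not\preceq d'$ for distinct $d,d'\in D$, and for every $x\in L$: there exists $f\in F$ with $f\preceq x$ if and only if $x\not\preceq d$ for every $d\in D$. Transversal construction. It is applied to an arbitrary fixed non-empty finite set $F=\{f_1,\dots,f_m\}$ of pairwise incomparable elements of $L$. For each $f_i$ fix a finite connected decomposition $f_i=\bigvee_{j=1}^{k_i}c_{i,j}$ (each $c_{i,j}$ connected), and let $F_c=\bigcup_{i=1}^m\{c_{i,j}:1\le j\le k_i\}$ be the set of all connected elements appearing in these decompositions. A quasitransversal is a subset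 $M\subseteq F_c$ such that (T1) any two distinct elements of $M$ are incomparable, and (T2) for every $f\in F$ there exists $c\in M$ with $c\preceq f$. For quasitransversals $M,M'$ put $M\trianglelefteq M'$ if and only if for every $c'\in M'$ there exists $c\in M$ with $c\preceq c'$; this is a partial order on the set of quasitransversals. A transversal is a quasitransversal that is maximal with respect to $\trianglelefteq$. The result of the construction is $D=\{D(M): M \text{ is a transversal}\}$, where $D(M)$ denotes the element of $L$ for which $(M,\{D(M)\})$ is a finite duality; that is, if $M=\{c_1,\dots,c_n\}$ and $(c_i,d_i)$ is a duality pair for $i=1,\dots,n$, then $D(M)=d_1\wedge d_2\wedge\dots\wedge d_n$. *)

theory Defs
  imports Main
begin

class heyting_algebra = bounded_lattice +
  fixes heyting_imp :: "'a \<Rightarrow> 'a \<Rightarrow> 'a"  (infixr "\<rightarrow>\<^sub>H" 60)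
  assumes heyting_residuation: "p \<le> (q \<rightarrow>\<^sub>H r) \<longleftrightarrow> inf p q \<le> r"

definition connected_element :: "'a::lattice \<Rightarrow> bool" where
  "connected_element a \<longleftrightarrow> (\<forall>b c. a = sup b c \<longrightarrow> a = b \<or> a = c)"

(* Inserting bot does not change a nonempty join and makes the empty join equal to bot. *)
definition finite_join :: "'a::bounded_lattice set \<Rightarrow> 'a" where
  "finite_join S = Sup_fin (insert bot S)"

definition connected_decomposition :: "'a::bounded_lattice \<Rightarrow> 'a set \<Rightarrow> bool" where
  "connected_decomposition a S \<longleftrightarrow>
     finite S \<and> (\<forall>c\<in>S. connected_element c) \<and> a = finite_join S"

definition has_finite_connected_decompositions :: "'a::bounded_lattice itself \<Rightarrow> bool" where
  "has_finite_connected_decompositions _ \<longleftrightarrow> (\<forall>a::'a. \<exists>S. connected_decomposition a S)"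

definition duality_pair :: "'a::order \<Rightarrow> 'a \<Rightarrow> bool" where
  "duality_pair f d \<longleftrightarrow> (\<forall>x. f \<le> x \<longleftrightarrow> \<not> x \<le> d)"

definition primal :: "'a::order \<Rightarrow> bool" where
  "primal f \<longleftrightarrow> (\<exists>d. duality_pair f d)"

definition finite_join_of_primals :: "'a::bounded_lattice \<Rightarrow> bool" where
  "finite_join_of_primals a \<longleftrightarrow> (\<exists>P. finite P \<and> (\<forall>p\<in>P. primal p) \<and> a = finite_join P)"

definition pairwise_incomparable :: "'a::order set \<Rightarrow> bool" where
  "pairwise_incomparable S \<longleftrightarrow> (\<forall>a\<in>S. \<forall>b\<in>S. a \<noteq> b \<longrightarrow> \<not> a \<le> b)"

definition finite_duality :: "'a::order set \<Rightarrow> 'a set \<Rightarrow> bool" where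
  "finite_duality F D \<longleftrightarrow>
     finite F \<and> finite D \<and> pairwise_incomparable F \<and> pairwise_incomparable D \<and>
     (\<forall>x. (\<exists>f\<in>F. f \<le> x) \<longleftrightarrow> (\<forall>d\<in>D. \<not> x \<le> d))"

(* The construction depends on a choice of one connected decomposition C f for each f in F. *)
definition decomposition_choice :: "'a::bounded_lattice set \<Rightarrow> ('a \<Rightarrow> 'a set) \<Rightarrow> bool" where
  "decomposition_choice F C \<longleftrightarrow> (\<forall>f\<in>F. connected_decomposition f (C f))"

definition quasitransversal :: "'a::order set \<Rightarrow> ('a \<Rightarrow> 'a set) \<Rightarrow> 'a set \<Rightarrow> bool" where
  "quasitransversal F C M \<longleftrightarrow>
     M \<subseteq> (\<Union>f\<in>F. C f) \<and> pairwise_incomparable M \<and> (\<forall>f\<in>F. \<exists>c\<in>M. c \<le> f)"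

definition transversal_le :: "'a::order set \<Rightarrow> 'a set \<Rightarrow> bool"  (infix "\<unlhd>\<^sub>T" 50) where
  "M \<unlhd>\<^sub>T M' \<longleftrightarrow> (\<forall>c'\<in>M'. \<exists>c\<in>M. c \<le> c')"

definition transversal :: "'a::order set \<Rightarrow> ('a \<Rightarrow> 'a set) \<Rightarrow> 'a set \<Rightarrow> bool" where
  "transversal F C M \<longleftrightarrow>
     quasitransversal F C M \<and> (\<forall>M'. quasitransversal F C M' \<and> M \<unlhd>\<^sub>T M' \<longrightarrow> M' = M)"

(* The element D(M) is described by its defining property that (M, {D(M)}) is a finite duality.
   It is unique if it exists; it exists, and is the meet of the duals, if M consists of primals.
   The only transversal that can lack D(M) when all elements of F are joins of primals is
   M = {bot}, for F = {bot} (bot is connected, but not primal); it contributes no element,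
   and then ({bot}, {}) is indeed a finite duality. *)
definition transversal_construction :: "'a::order set \<Rightarrow> ('a \<Rightarrow> 'a set) \<Rightarrow> 'a set" where
  "transversal_construction F C = {d. \<exists>M. transversal F C M \<and> finite_duality M {d}}"

lemma finite_duality_singleton_unique:
  assumes "finite_duality M {d}" "finite_duality M {d'}"
  shows "d = d'"
proof -
  have "x \<le> d \<longleftrightarrow> x \<le> d'" for x
    using assms by (auto simp: finite_duality_def)
  then show ?thesis by (meson order.antisym order.refl)
qed

lemma finite_duality_meet_of_duals:
  fixes M :: "'a::bounded_lattice set"
  assumes "finite M" "pairwise_incomparable M" "\<And>c. c \<in> M \<Longrightarrow> duality_pair c (d c)"
  shows "finite_duality M {Inf_fin (insert top (d ` M))}"
proof -
  have "x \<le> Inf_fin (insert top (d ` M)) \<longleftrightarrow> (\<forall>c\<in>M. x \<le> d c)" for x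
    using assms(1) by (simp add: Inf_fin.bounded_iff)
  then show ?thesis
    using assms unfolding finite_duality_def duality_pair_def pairwise_incomparable_def by auto
qed

end

theory Submission
  imports Defs
begin

text \<open>
  In a Heyting algebra meets distribute over joins, so a connected element other than the
  bottom is join-prime: if it lies below a finite join, it lies below one of the joinands.
  Two consequences drive the proof.

  First, for every \<open>x\<close>, some \<open>f \<in> F\<close> lies below \<open>x\<close> if and only if every transversal contains
  an element below \<open>x\<close> (\<open>transversals_detect\<close>). Indeed, if no \<open>f \<in> F\<close> lies below \<open>x\<close>, then
  every \<open>f\<close> has a component not below \<open>x\<close>; the minimal components of this kind form a
  quasitransversal, and passing to a transversal above it only enlarges the elements, which
  therefore still avoid \<open>x\<close>. Once every transversal \<open>M\<close> has a dual element \<open>D(M)\<close>, this says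
  that the elements \<open>D(M)\<close> are dual to \<open>F\<close>; they form an antichain because
  \<open>D(M) \<le> D(M')\<close> forces \<open>M \<unlhd>\<^sub>T M'\<close>, hence \<open>M = M'\<close>. Dual elements exist because a transversal
  consists of maximal components of elements of \<open>F\<close> (\<open>transversal_maximal_components\<close>), and
  a maximal component of a join of primals is itself one of these primals, unless it is the
  bottom. A transversal containing the bottom meets every down-set and so contributes no
  condition on \<open>x\<close>.

  Secondly, in a finite duality \<open>(F, D)\<close> every maximal component \<open>c \<noteq> bot\<close> of an \<open>f \<in> F\<close> is
  primal (\<open>finite_duality_component_primal\<close>). With \<open>g\<close> the join of the other components, the
  relation \<open>c \<le> x\<close> is equivalent to \<open>f \<le> sup (inf c x) g\<close>. Since \<open>F\<close> is an antichain, \<open>f\<close> is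
  the only element of \<open>F\<close> that can lie below \<open>sup (inf c x) g \<le> f\<close>, so the relation is decided
  by \<open>D\<close>, and residuation moves \<open>c\<close> to the other side: the elements \<open>c \<rightarrow>\<^sub>H d\<close> with
  \<open>d \<in> D\<close>, \<open>g \<le> d\<close> are jointly dual to \<open>c\<close>. As \<open>c\<close> is join-prime, they have a largest
  member, which is the dual of \<open>c\<close>. The converse half of the theorem then follows from the
  direct half, since the right-hand side of a finite duality is determined by the left-hand side.
\<close>

section \<open>Finite joins and join-primeness\<close>

lemma finite_join_le_iff:
  fixes S :: "'a::bounded_lattice set"
  assumes "finite S"
  shows "finite_join S \<le> x \<longleftrightarrow> (\<forall>s\<in>S. s \<le> x)"
  using assms by (simp add: finite_join_def Sup_fin.bounded_iff)

lemma finite_join_upper: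
  fixes S :: "'a::bounded_lattice set"
  assumes "finite S" "s \<in> S"
  shows "s \<le> finite_join S"
  using finite_join_le_iff[OF assms(1), of "finite_join S"] assms(2) by blast

lemma connected_le_sup:
  fixes c :: "'a::heyting_algebra"
  assumes "connected_element c" "c \<le> sup a b"
  shows "c \<le> a \<or> c \<le> b"
proof -
  have "a \<le> c \<rightarrow>\<^sub>H sup (inf c a) (inf c b)" "b \<le> c \<rightarrow>\<^sub>H sup (inf c a) (inf c b)"
    by (simp_all add: heyting_residuation inf_commute)
  then have "inf (sup a b) c \<le> sup (inf c a) (inf c b)"
    by (simp flip: heyting_residuation)
  moreover have "inf (sup a b) c = c"
    using assms(2) by (simp add: inf_absorb2)
  ultimately have "c = sup (inf c a) (inf c b)"
    by (simp add: order.antisym)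
  then have "c = inf c a \<or> c = inf c b"
    using assms(1) unfolding connected_element_def by blast
  then show ?thesis
    by (metis inf_le2)
qed

lemma connected_le_finite_join:
  fixes c :: "'a::heyting_algebra"
  assumes "finite S" "connected_element c" "c \<noteq> bot" "c \<le> finite_join S"
  shows "\<exists>s\<in>S. c \<le> s"
  using assms(1,4)
proof (induction S)
  case empty
  then show ?case
    using assms(3) by (simp add: finite_join_def bot_unique)
next
  case (insert s S)
  have "finite_join (insert s S) \<le> sup s (finite_join S)"
    using insert.hyps finite_join_upper[of S]
    by (simp add: finite_join_le_iff le_supI2)
  then have "c \<le> s \<or> c \<le> finite_join S"
    using insert.prems connected_le_sup[OF assms(2)] by (meson order_trans)
  then show ?case
    using insert.IH by blast
qed

lemma primal_le_finite_join:
  fixes p :: "'a::bounded_lattice"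
  assumes "finite S" "primal p" "p \<le> finite_join S"
  shows "\<exists>s\<in>S. p \<le> s"
  using assms unfolding primal_def duality_pair_def by (meson finite_join_le_iff)

definition maximal_in :: "'a::order set \<Rightarrow> 'a \<Rightarrow> bool" where
  "maximal_in S m \<longleftrightarrow> m \<in> S \<and> (\<forall>s\<in>S. m \<le> s \<longrightarrow> s = m)"

lemma maximal_in_above:
  assumes "finite S" "s \<in> S"
  obtains m where "maximal_in S m" "s \<le> m"
  using finite_has_maximal2[OF assms] unfolding maximal_in_def by metis

text \<open>
  The component lies below one of the primals, which in turn lies below a component;
  maximality closes the circle.
\<close>
lemma maximal_component_primal:
  fixes f :: "'a::heyting_algebra"
  assumes "connected_decomposition f S" "finite_join_of_primals f" "maximal_in S m" "m \<noteq> bot"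
  shows "primal m"
proof -
  have S: "finite S" "f = finite_join S" "connected_element m" "m \<in> S"
    using assms by (auto simp: connected_decomposition_def maximal_in_def)
  obtain P where P: "finite P" "\<forall>p\<in>P. primal p" "f = finite_join P"
    using assms(2) unfolding finite_join_of_primals_def by blast
  have "m \<le> finite_join P"
    using finite_join_upper[OF S(1,4)] S(2) P(3) by simp
  then obtain p where p: "p \<in> P" "m \<le> p"
    using connected_le_finite_join[OF P(1) S(3) assms(4)] by blast
  have "p \<le> finite_join S"
    using finite_join_upper[OF P(1) p(1)] S(2) P(3) by simp
  then obtain s where s: "s \<in> S" "p \<le> s"
    using primal_le_finite_join[OF S(1)] P(2) p(1) by blast
  then have "s = m"
    using assms(3) p(2) order_trans unfolding maximal_in_def by blast
  then have "p = m"
    using s p by (simp add: order.antisym)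
  then show ?thesis
    using P(2) p(1) by blast
qed

section \<open>Existence and structure of transversals\<close>

definition minimal_elements :: "'a::order set \<Rightarrow> 'a set" where
  "minimal_elements S = {m \<in> S. \<forall>s\<in>S. s \<le> m \<longrightarrow> s = m}"

lemma minimal_elements_subset: "minimal_elements S \<subseteq> S"
  by (auto simp: minimal_elements_def)

lemma minimal_elements_incomparable: "pairwise_incomparable (minimal_elements S)"
  by (auto simp: minimal_elements_def pairwise_incomparable_def)

lemma minimal_elements_below:
  assumes "finite S" "s \<in> S"
  shows "\<exists>m\<in>minimal_elements S. m \<le> s"
  using finite_has_minimal2[OF assms] unfolding minimal_elements_def by auto

lemma quasitransversal_minimal_elements:
  assumes "finite S" "S \<subseteq> (\<Union>f\<in>F. C f)" "\<forall>f\<in>F. \<exists>c\<in>S. c \<le> f"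
  shows "quasitransversal F C (minimal_elements S)"
  unfolding quasitransversal_def
  using assms minimal_elements_subset[of S] minimal_elements_incomparable[of S]
    minimal_elements_below[OF assms(1)] by (meson order_trans)

lemma transversal_le_antisym:
  assumes "pairwise_incomparable M" "pairwise_incomparable M'" "M \<unlhd>\<^sub>T M'" "M' \<unlhd>\<^sub>T M"
  shows "M = M'"
proof -
  have "A \<subseteq> B" if AB: "pairwise_incomparable A" "A \<unlhd>\<^sub>T B" "B \<unlhd>\<^sub>T A" for A B :: "'a set"
  proof
    fix a
    assume a: "a \<in> A"
    then obtain b where b: "b \<in> B" "b \<le> a"
      using AB(3) unfolding transversal_le_def by blast
    then obtain a' where a': "a' \<in> A" "a' \<le> b"
      using AB(2) unfolding transversal_le_def by blast
    have "a' \<le> a"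
      using a'(2) b(2) by (rule order_trans)
    then have "a' = a"
      using AB(1) a a'(1) unfolding pairwise_incomparable_def by blast
    then have "a = b"
      using a'(2) b(2) order.antisym by blast
    then show "a \<in> B"
      using b(1) by simp
  qed
  then show ?thesis
    using assms by blast
qed

lemma transversal_le_trans:
  assumes "M \<unlhd>\<^sub>T M'" "M' \<unlhd>\<^sub>T M''"
  shows "M \<unlhd>\<^sub>T M''"
  using assms unfolding transversal_le_def by (meson order_trans)

lemma components_finite:
  assumes "finite F" "decomposition_choice F C"
  shows "finite (\<Union>f\<in>F. C f)"
  using assms by (auto simp: decomposition_choice_def connected_decomposition_def)

text \<open>
  The relation \<open>M \<unlhd>\<^sub>T M'\<close> reverses the inclusion of the generated up-sets within the finite
  set of components, so a quasitransversal with the smallest up-set is maximal.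
\<close>
lemma transversal_above:
  assumes fin: "finite (\<Union>f\<in>F. C f)" and M: "quasitransversal F C M"
  obtains N where "transversal F C N" "M \<unlhd>\<^sub>T N"
proof -
  define U where "U N = {x \<in> (\<Union>f\<in>F. C f). \<exists>c\<in>N. c \<le> x}" for N
  have U_finite: "finite (U N)" for N
    using fin unfolding U_def by (rule rev_finite_subset) blast
  have le_iff: "N \<unlhd>\<^sub>T N' \<longleftrightarrow> U N' \<subseteq> U N" if "quasitransversal F C N'" for N N'
  proof
    show "U N' \<subseteq> U N" if "N \<unlhd>\<^sub>T N'"
      using that unfolding U_def transversal_le_def by (blast intro: order_trans)
    show "N \<unlhd>\<^sub>T N'" if "U N' \<subseteq> U N"
      using that \<open>quasitransversal F C N'\<close>
      unfolding U_def transversal_le_def quasitransversal_def by blast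
  qed
  have "quasitransversal F C M \<and> M \<unlhd>\<^sub>T M"
    using M by (auto simp: transversal_le_def)
  then obtain N where N: "quasitransversal F C N" "M \<unlhd>\<^sub>T N"
    and least: "\<And>N'. quasitransversal F C N' \<and> M \<unlhd>\<^sub>T N' \<Longrightarrow> card (U N) \<le> card (U N')"
    using ex_has_least_nat[of "\<lambda>N. quasitransversal F C N \<and> M \<unlhd>\<^sub>T N" M "\<lambda>N. card (U N)"]
    by blast
  have "N' = N" if N': "quasitransversal F C N'" "N \<unlhd>\<^sub>T N'" for N'
  proof -
    have "U N' \<subseteq> U N"
      using le_iff N' by blast
    moreover have "card (U N) \<le> card (U N')"
      using least N' N(2) transversal_le_trans by blast
    ultimately have "U N' = U N"
      using card_seteq[OF U_finite] by blast
    then have "N' \<unlhd>\<^sub>T N"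
      using le_iff N(1) by blast
    then show ?thesis
      using N N' transversal_le_antisym unfolding quasitransversal_def by blast
  qed
  then have "transversal F C N"
    using N(1) unfolding transversal_def by blast
  then show thesis
    using N(2) that by blast
qed

text \<open>
  The components of the elements of \<open>F\<close> that do not lie below \<open>x\<close> yield a transversal
  avoiding \<open>x\<close>, since elements only grow when passing to a larger quasitransversal.
\<close>
lemma transversals_detect:
  fixes F :: "'a::bounded_lattice set"
  assumes "finite F" "decomposition_choice F C"
  shows "(\<exists>f\<in>F. f \<le> x) \<longleftrightarrow> (\<forall>M. transversal F C M \<longrightarrow> (\<exists>c\<in>M. c \<le> x))"
proof
  show "\<forall>M. transversal F C M \<longrightarrow> (\<exists>c\<in>M. c \<le> x)" if "\<exists>f\<in>F. f \<le> x"
    using that unfolding transversal_def quasitransversal_def by (meson order_trans)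
next
  assume all: "\<forall>M. transversal F C M \<longrightarrow> (\<exists>c\<in>M. c \<le> x)"
  show "\<exists>f\<in>F. f \<le> x"
  proof (rule ccontr)
    assume none: "\<not> (\<exists>f\<in>F. f \<le> x)"
    define S where "S = {c \<in> (\<Union>f\<in>F. C f). \<not> c \<le> x}"
    have fin: "finite (\<Union>f\<in>F. C f)"
      by (rule components_finite[OF assms])
    have "\<exists>c\<in>S. c \<le> f" if f: "f \<in> F" for f
    proof -
      have C: "finite (C f)" "f = finite_join (C f)"
        using assms(2) f by (auto simp: decomposition_choice_def connected_decomposition_def)
      have "\<not> finite_join (C f) \<le> x"
        using none f C(2) by auto
      then obtain c where c: "c \<in> C f" "\<not> c \<le> x"
        using finite_join_le_iff[OF C(1)] by blast
      then have "c \<le> f"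
        using finite_join_upper[OF C(1)] C(2) by metis
      then show ?thesis
        using c f unfolding S_def by blast
    qed
    moreover have "S \<subseteq> (\<Union>f\<in>F. C f)"
      by (auto simp: S_def)
    ultimately have "quasitransversal F C (minimal_elements S)"
      using finite_subset[OF _ fin] by (intro quasitransversal_minimal_elements) blast+
    then obtain N where N: "transversal F C N" "minimal_elements S \<unlhd>\<^sub>T N"
      using transversal_above[OF fin] by blast
    obtain c where c: "c \<in> N" "c \<le> x"
      using all N(1) by blast
    then obtain s where "s \<in> S" "s \<le> c"
      using N(2) minimal_elements_subset unfolding transversal_le_def by blast
    then show False
      using c(2) order_trans unfolding S_def by blast
  qed
qed

text \<open>
  The chosen decompositions can be redundant and then have components that are not primal. Transversals avoid these: each \<open>f \<in> F\<close> lies above an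
  element of \<open>M\<close>, hence has a maximal component above an element of \<open>M\<close>, and the
  quasitransversal made of such components lies above \<open>M\<close>, so it equals \<open>M\<close>.
\<close>
lemma transversal_maximal_components:
  fixes F :: "'a::heyting_algebra set"
  assumes "finite F" "pairwise_incomparable F" "decomposition_choice F C"
    and M: "transversal F C M" and c: "c \<in> M"
  obtains f where "f \<in> F" "maximal_in (C f) c"
proof -
  have "\<exists>m. maximal_in (C f) m \<and> (\<exists>a\<in>M. a \<le> m)" if f: "f \<in> F" for f
  proof -
    have C: "finite (C f)" "f = finite_join (C f)"
      using assms(3) f by (auto simp: decomposition_choice_def connected_decomposition_def)
    obtain a where a: "a \<in> M" "a \<le> f"
      using M f unfolding transversal_def quasitransversal_def by blast
    then obtain f' where f': "f' \<in> F" "a \<in> C f'"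
      using M unfolding transversal_def quasitransversal_def by blast
    have "\<exists>s\<in>C f. a \<le> s"
    proof (cases "a = bot")
      case True
      have "C f \<noteq> {}"
      proof
        \<comment> \<open>An empty decomposition means \<open>f = bot\<close>; then \<open>F = {bot}\<close> has no components at all.\<close>
        assume empty: "C f = {}"
        then have "f = bot"
          using C(2) by (simp add: finite_join_def)
        then have "f' = f"
          using assms(2) f f'(1) unfolding pairwise_incomparable_def by (metis bot_least)
        then show False
          using f'(2) empty by simp
      qed
      then show ?thesis
        using True by auto
    next
      case False
      have "connected_element a"
        using assms(3) f' by (auto simp: decomposition_choice_def connected_decomposition_def)
      then show ?thesis
        using connected_le_finite_join[OF C(1)] False a(2) C(2) by metis
    qed
    then obtain s where "s \<in> C f" "a \<le> s"
      by blast
    moreover obtain m where "maximal_in (C f) m" "s \<le> m"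
      using maximal_in_above[OF C(1) \<open>s \<in> C f\<close>] .
    ultimately show ?thesis
      using a(1) order_trans by blast
  qed
  then obtain m where m: "\<And>f. f \<in> F \<Longrightarrow> maximal_in (C f) (m f) \<and> (\<exists>a\<in>M. a \<le> m f)"
    by metis
  have "m f \<le> f" if "f \<in> F" for f
    using m[OF that] that assms(3) finite_join_upper[of "C f"]
    unfolding maximal_in_def decomposition_choice_def connected_decomposition_def by metis
  then have "quasitransversal F C (minimal_elements (m ` F))"
    using m assms(1) unfolding maximal_in_def
    by (intro quasitransversal_minimal_elements) auto
  moreover have "M \<unlhd>\<^sub>T minimal_elements (m ` F)"
    using m minimal_elements_subset[of "m ` F"] unfolding transversal_le_def by blast
  ultimately have "minimal_elements (m ` F) = M"
    using M unfolding transversal_def by blast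
  then have "c \<in> m ` F"
    using c minimal_elements_subset by blast
  then show thesis
    using m that by blast
qed

section \<open>From joins of primals to a finite duality\<close>

lemma transversal_dual_or_bot:
  fixes F :: "'a::heyting_algebra set"
  assumes "finite F" "pairwise_incomparable F" "decomposition_choice F C"
    and primals: "\<forall>f\<in>F. finite_join_of_primals f" and M: "transversal F C M"
  shows "(\<exists>d. finite_duality M {d}) \<or> bot \<in> M"
proof (cases "bot \<in> M")
  case False
  have "\<exists>d. duality_pair c d" if c: "c \<in> M" for c
  proof -
    obtain f where f: "f \<in> F" "maximal_in (C f) c"
      using transversal_maximal_components[OF assms(1-3) M c] .
    then have "primal c"
      using assms(3) primals maximal_component_primal c False
      unfolding decomposition_choice_def by metis
    then show ?thesis
      unfolding primal_def .
  qed
  then obtain d where "\<And>c. c \<in> M \<Longrightarrow> duality_pair c (d c)"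
    by metis
  moreover have "finite M" "pairwise_incomparable M"
    using M finite_subset[OF _ components_finite[OF assms(1,3)]]
    unfolding transversal_def quasitransversal_def by auto
  ultimately show ?thesis
    using finite_duality_meet_of_duals by blast
qed simp

theorem finite_duality_transversal_construction:
  fixes F :: "'a::heyting_algebra set"
  assumes "finite F" "pairwise_incomparable F" "decomposition_choice F C"
    and primals: "\<forall>f\<in>F. finite_join_of_primals f"
  shows "finite_duality F (transversal_construction F C)"
proof -
  let ?D = "transversal_construction F C"
  have "{M. transversal F C M} \<subseteq> Pow (\<Union>f\<in>F. C f)"
    unfolding transversal_def quasitransversal_def by blast
  then have "finite {M. transversal F C M}"
    using components_finite[OF assms(1,3)] finite_subset by blast
  moreover have "?D \<subseteq> (\<lambda>M. THE d. finite_duality M {d}) ` {M. transversal F C M}"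
  proof
    fix d
    assume "d \<in> ?D"
    then obtain M where M: "transversal F C M" "finite_duality M {d}"
      unfolding transversal_construction_def by blast
    then have "(THE d. finite_duality M {d}) = d"
      using finite_duality_singleton_unique by blast
    then show "d \<in> (\<lambda>M. THE d. finite_duality M {d}) ` {M. transversal F C M}"
      using M(1) by blast
  qed
  ultimately have fin: "finite ?D"
    by (meson finite_surj)
  have antichain: "pairwise_incomparable ?D"
    unfolding pairwise_incomparable_def
  proof (intro ballI impI notI)
    fix d d'
    assume "d \<in> ?D" "d' \<in> ?D" and neq: "d \<noteq> d'" and le: "d \<le> d'"
    then obtain M M' where M: "transversal F C M" "finite_duality M {d}"
      and M': "transversal F C M'" "finite_duality M' {d'}"
      unfolding transversal_construction_def by blast
    have "\<exists>c\<in>M. c \<le> c'" if c': "c' \<in> M'" for c'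
    proof -
      have "\<not> c' \<le> d'"
        using M'(2) c' unfolding finite_duality_def by blast
      then have "\<not> c' \<le> d"
        using le order_trans by blast
      then show ?thesis
        using M(2) unfolding finite_duality_def by blast
    qed
    then have "M' = M"
      using M(1) M'(1) unfolding transversal_def transversal_le_def by blast
    then show False
      using M(2) M'(2) neq finite_duality_singleton_unique by blast
  qed
  have "(\<exists>f\<in>F. f \<le> x) \<longleftrightarrow> (\<forall>d\<in>?D. \<not> x \<le> d)" for x
  proof -
    have "(\<exists>c\<in>M. c \<le> x) \<longleftrightarrow> (\<forall>d. finite_duality M {d} \<longrightarrow> \<not> x \<le> d)"
      if "transversal F C M" for M
    proof -
      have "bot \<in> M \<Longrightarrow> \<exists>c\<in>M. c \<le> x"
        using bot_least by blast
      then show ?thesis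
        using transversal_dual_or_bot[OF assms that] unfolding finite_duality_def by blast
    qed
    then show ?thesis
      unfolding transversals_detect[OF assms(1,3)] transversal_construction_def by blast
  qed
  then show ?thesis
    using assms(1,2) fin antichain unfolding finite_duality_def by blast
qed

section \<open>From a finite duality to joins of primals\<close>

text \<open>
  Since \<open>c\<close> is join-prime and below no member of \<open>E\<close>, it is not below the join of \<open>E\<close>
  either. Hence the join lies below a member of \<open>E\<close>: it is the largest member, and alone
  does the work of \<open>E\<close>.
\<close>
lemma connected_dual_set_primal:
  fixes c :: "'a::heyting_algebra"
  assumes "connected_element c" "c \<noteq> bot" "finite E"
    and dual: "\<And>x. c \<le> x \<longleftrightarrow> (\<forall>e\<in>E. \<not> x \<le> e)"
  shows "primal c"
proof -
  have "\<not> c \<le> finite_join E"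
    using connected_le_finite_join[OF assms(3,1,2)] dual[of c] by auto
  then obtain e where "e \<in> E" "finite_join E \<le> e"
    using dual by blast
  then have "duality_pair c (finite_join E)"
    using dual finite_join_upper[OF assms(3)] unfolding duality_pair_def by (meson order_trans)
  then show ?thesis
    unfolding primal_def by blast
qed

text \<open>
  Meeting with \<open>c\<close> before joining with \<open>g\<close>, the join of the other components, confines the
  test element to the elements below \<open>f\<close>, where no other element of \<open>F\<close> interferes.
\<close>
lemma finite_duality_component_primal:
  fixes F :: "'a::heyting_algebra set"
  assumes FD: "finite_duality F D" and f: "f \<in> F" and S: "connected_decomposition f S"
    and c: "maximal_in S c" "c \<noteq> bot"
  shows "primal c"
proof -
  have finS: "finite S" and fS: "f = finite_join S" and conn: "connected_element c"
    and cS: "c \<in> S"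
    using S c(1) by (auto simp: connected_decomposition_def maximal_in_def)
  define g where "g = finite_join (S - {c})"
  have cg: "\<not> c \<le> g"
    using connected_le_finite_join[of "S - {c}" c] finS conn c
    unfolding g_def maximal_in_def by auto
  have gf: "g \<le> f" and cf: "c \<le> f"
    using finS cS finite_join_upper[OF finS] by (auto simp: g_def fS finite_join_le_iff)
  have f_le: "f \<le> y" if "c \<le> y" "g \<le> y" for y
  proof -
    have "\<forall>s\<in>S - {c}. s \<le> y"
      using that(2) finS unfolding g_def by (simp add: finite_join_le_iff)
    then show ?thesis
      unfolding fS finite_join_le_iff[OF finS] using that(1) by blast
  qed
  show ?thesis
  proof (rule connected_dual_set_primal[OF conn c(2)])
    show "finite ((\<lambda>d. c \<rightarrow>\<^sub>H d) ` {d \<in> D. g \<le> d})"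
      using FD by (simp add: finite_duality_def)
    fix x
    let ?y = "sup (inf c x) g"
    have "c \<le> x \<longleftrightarrow> f \<le> ?y"
    proof
      show "f \<le> ?y" if "c \<le> x"
        using that by (intro f_le) (simp_all add: inf_absorb1)
      show "c \<le> x" if "f \<le> ?y"
      proof -
        have "c \<le> inf c x"
          using connected_le_sup[OF conn, of "inf c x" g] that cf cg order_trans by blast
        then show ?thesis by simp
      qed
    qed
    also have "\<dots> \<longleftrightarrow> (\<exists>f'\<in>F. f' \<le> ?y)"
    proof
      have "?y \<le> f"
        using gf cf by (simp add: le_infI1)
      moreover have "pairwise_incomparable F"
        using FD by (simp add: finite_duality_def)
      ultimately show "f \<le> ?y" if "\<exists>f'\<in>F. f' \<le> ?y"
        using that f unfolding pairwise_incomparable_def by (metis order_trans)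
    qed (use f in blast)
    also have "\<dots> \<longleftrightarrow> (\<forall>d\<in>D. \<not> ?y \<le> d)"
      using FD unfolding finite_duality_def by blast
    also have "\<dots> \<longleftrightarrow> (\<forall>e\<in>(\<lambda>d. c \<rightarrow>\<^sub>H d) ` {d \<in> D. g \<le> d}. \<not> x \<le> e)"
      by (auto simp: heyting_residuation inf_commute)
    finally show "c \<le> x \<longleftrightarrow> (\<forall>e\<in>(\<lambda>d. c \<rightarrow>\<^sub>H d) ` {d \<in> D. g \<le> d}. \<not> x \<le> e)" .
  qed
qed

lemma finite_duality_join_of_primals:
  fixes F :: "'a::heyting_algebra set"
  assumes "finite_duality F D" "f \<in> F" and S: "connected_decomposition f S"
  shows "finite_join_of_primals f"
proof -
  define P where "P = {c. maximal_in S c \<and> c \<noteq> bot}"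
  have finS: "finite S" and fS: "f = finite_join S"
    using S by (auto simp: connected_decomposition_def)
  have PS: "P \<subseteq> S"
    by (auto simp: P_def maximal_in_def)
  then have finP: "finite P"
    using finS finite_subset by blast
  have "s \<le> finite_join P" if s: "s \<in> S" for s
  proof -
    obtain m where m: "maximal_in S m" "s \<le> m"
      using maximal_in_above[OF finS s] .
    have "m \<le> finite_join P"
      using m(1) finite_join_upper[OF finP] by (cases "m = bot") (auto simp: P_def)
    then show ?thesis
      using m(2) order_trans by blast
  qed
  then have "f \<le> finite_join P"
    using fS finite_join_le_iff[OF finS] by blast
  moreover have "finite_join P \<le> f"
    using fS finite_join_le_iff[OF finP] finite_join_upper[OF finS] PS by blast
  ultimately have "f = finite_join P"
    by (rule order.antisym)
  moreover have "\<forall>p\<in>P. primal p"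
    using finite_duality_component_primal[OF assms] by (simp add: P_def)
  ultimately show ?thesis
    using finP unfolding finite_join_of_primals_def by blast
qed

text \<open>
  Both right-hand sides consist of the maximal elements of the down-set of all \<open>x\<close> with no
  element of \<open>F\<close> below them.
\<close>
lemma finite_duality_right_unique:
  assumes "finite_duality F D" "finite_duality F D'"
  shows "D = D'"
proof -
  have "A \<subseteq> B" if AB: "finite_duality F A" "finite_duality F B" for A B
  proof
    have dual: "(\<exists>d\<in>D. x \<le> d) \<longleftrightarrow> \<not> (\<exists>f\<in>F. f \<le> x)" if FD: "finite_duality F D" for D x
    proof -
      have "\<forall>x. (\<exists>f\<in>F. f \<le> x) \<longleftrightarrow> (\<forall>d\<in>D. \<not> x \<le> d)"
        using FD unfolding finite_duality_def by (elim conjE)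
      from spec[OF this, of x] show ?thesis
        by simp
    qed
    have incomparable: "pairwise_incomparable A"
      using AB(1) unfolding finite_duality_def by (elim conjE)
    have down_set: "(\<exists>d\<in>A. x \<le> d) \<longleftrightarrow> (\<exists>d\<in>B. x \<le> d)" for x
      by (rule trans[OF dual[OF AB(1)] dual[OF AB(2), symmetric]])
    fix a
    assume a: "a \<in> A"
    have "\<exists>d\<in>B. a \<le> d"
      by (rule down_set[THEN iffD1, OF bexI[OF order_refl a]])
    then obtain b where b: "b \<in> B" "a \<le> b" ..
    have "\<exists>d\<in>A. b \<le> d"
      by (rule down_set[THEN iffD2, OF bexI[OF order_refl b(1)]])
    then obtain a' where a': "a' \<in> A" "b \<le> a'" ..
    have "a \<le> a'"
      using b(2) a'(2) by (rule order_trans)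
    then have "a' = a"
      using bspec[OF bspec[OF incomparable[unfolded pairwise_incomparable_def] a] a'(1)] by simp
    then have "a = b"
      using a'(2) b(2) by (simp add: order.antisym)
    then show "a \<in> B"
      using b(1) by simp
  qed
  from this[OF assms] this[OF assms(2,1)] show ?thesis
    by (rule equalityI)
qed

section \<open>The correspondence\<close>

theorem mainTheorem5:
  fixes F D :: "'a::heyting_algebra set"
  assumes "has_finite_connected_decompositions TYPE('a)"
  shows
    "(finite F \<and> pairwise_incomparable F \<and> (\<forall>f\<in>F. finite_join_of_primals f) \<longrightarrow>
       (\<forall>C. decomposition_choice F C \<and> D = transversal_construction F C
          \<longrightarrow> finite_duality F D))
     \<and>
     (finite_duality F D \<longrightarrow>
       (\<forall>f\<in>F. finite_join_of_primals f) \<and>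
       (\<forall>C. decomposition_choice F C \<longrightarrow> D = transversal_construction F C))"
proof (intro conjI impI)
  assume "finite F \<and> pairwise_incomparable F \<and> (\<forall>f\<in>F. finite_join_of_primals f)"
  then show "\<forall>C. decomposition_choice F C \<and> D = transversal_construction F C
      \<longrightarrow> finite_duality F D"
    using finite_duality_transversal_construction by blast
next
  assume FD: "finite_duality F D"
  show primals: "\<forall>f\<in>F. finite_join_of_primals f"
  proof
    fix f
    assume f: "f \<in> F"
    obtain S where "connected_decomposition f S"
      using assms unfolding has_finite_connected_decompositions_def by blast
    then show "finite_join_of_primals f"
      by (rule finite_duality_join_of_primals[OF FD f])
  qed
  have F: "finite F" "pairwise_incomparable F"
    using FD by (simp_all add: finite_duality_def)
  show "\<forall>C. decomposition_choice F C \<longrightarrow> D = transversal_construction F C"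
  proof (intro allI impI)
    fix C
    assume "decomposition_choice F C"
    then have "finite_duality F (transversal_construction F C)"
      by (rule finite_duality_transversal_construction[OF F _ primals])
    then show "D = transversal_construction F C"
      by (rule finite_duality_right_unique[OF FD])
  qed
qed

end
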